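(* Let $f:\mathbb{R}^n\times\mathbb{R}^m\to\mathbb{R}$, $(\theta,\alpha)\mapsto f(\theta,\alpha)$, be twice continuously differentiable and satisfy the Lipschitz gradient conditions with constants $L_{11},L_{12},L_{22}>0$ listed in the context. Suppose that the game $\min_\theta\max_\alpha f(\theta,\alpha)$ is a PL-game with constant $\mu>0$, i.e. for every fixed $\theta$ the function $\alpha\mapsto -f(\theta,\alpha)$ is $\mu$-PL. Let $g(\theta)=\max_\alpha f(\theta,\alpha)$, let $g^*=\min_\theta g(\theta)$ be the optimal value of $g$, and define $$L=L_{11}+\frac{L_{12}^2}{\mu},\qquad \bar L=\max(L_{12},L_{22}),\qquad \Delta_g=g(\theta_0)-g^*,\qquad \kappa=\frac{L_{22}}{\mu}\ge 1,\qquad \rho=1-\frac1\kappa<1 .$$ Let $\varepsilon>0$ and $\Delta>0$. Run the Multi-step Gradient Descent Ascent algorithm (described in the context) from $(\theta_0,\alpha_0)$ with step sizes $\eta_1=\frac1{L_{22}}$, $\eta_2=\frac1L$ and positive integers $K,T$ such that $$K\ge N_1(\varepsilon)=\frac{2\log(1/\varepsilon)+\log(16\bar L^2\Delta/\mu)}{\log(1/\rho)},\qquad T\ge\frac{18L\Delta_g}{\varepsilon^2},$$ and assume that $g(\theta_t)-f(\theta_t,\alpha_0(\theta_t))\le\Delta$ for all iterations $t$ of the algorithm. Then there exists an iteration $t\in\{0,\dots,T-1\}$ such that $(\theta_t,\alpha_{t+1})$ is an $\varepsilon$-stationary point of the game, i.e. $$\|\nabla_\theta f(\theta_t,\alpha_{t+1})\|\le\varepsilon\quad\text{and}\quad\|\nabla_\alpha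 f(\theta_t,\alpha_{t+1})\|\le\varepsilon .$$
   Context: Norms are Euclidean. $\nabla_\theta f$ and $\nabla_\alpha f$ denote the partial gradients with respect to the first and second argument of $f$. Lipschitz gradient conditions: for all $\theta,\theta_1,\theta_2,\alpha,\alpha_1,\alpha_2$, $\|\nabla_\theta f(\theta_1,\alpha)-\nabla_\theta f(\theta_2,\alpha)\|\le L_{11}\|\theta_1-\theta_2\|$, $\|\nabla_\alpha f(\theta,\alpha_1)-\nabla_\alpha f(\theta,\alpha_2)\|\le L_{22}\|\alpha_1-\alpha_2\|$, $\|\nabla_\alpha f(\theta_1,\alpha)-\nabla_\alpha f(\theta_2,\alpha)\|\le L_{12}\|\theta_1-\theta_2\|$, $\|\nabla_\theta f(\theta,\alpha_1)-\nabla_\theta f(\theta,\alpha_2)\|\le L_{12}\|\alpha_1-\alpha_2\|$. PL condition: a differentiable function $h$ with minimum value $h^*=\min_x h(x)$ (assumed to exist) is $\mu$-PL if $\frac12\|\nabla h(x)\|^2\ge\mu\,(h(x)-h^* )$ for all $x$. In particular, in a PL-game the maximum defining $g(\theta)$ is attained for every $\theta$. The minimum $g^*$ of $g$ is assumed to exist. Multi-step Gradient Descent Ascent. Input: $K,T,\eta_1,\eta_2,\theta_0,\alpha_0$. For $t=0,\dots,T-1$: set $\alpha_0(\theta_t)=\alpha_t$; for $k=0,\dots,K-1$ set $\alpha_{k+1}(\theta_t)=\alpha_k(\theta_t)+\eta_1\nabla_\alpha f(\theta_t,\alpha_k(\theta_t))$; set $\alpha_{t+1}=\alpha_K(\theta_t)$;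 set $\theta_{t+1}=\theta_t-\eta_2\nabla_\theta f(\theta_t,\alpha_{t+1})$. (Here $\alpha_t$ denotes the outer iterate and $\alpha_k(\theta_t)$ the inner iterate at outer step $t$.) The condition $K\ge N_1(\varepsilon)$ is the solved form of $16\,\frac{\bar L^2\Delta}{\mu}\,\rho^K\le\varepsilon^2$; when $\rho=0$ the condition on $K$ is understood in this latter form. *)

theory Defs
  imports "HOL-Analysis.Analysis"
begin

text \<open>The value is meaningful only at points of differentiability;
  there \<open>gradient_eqI\<close> shows that it is the usual gradient.\<close>

definition gradient :: "('a::real_inner \<Rightarrow> real) \<Rightarrow> 'a \<Rightarrow> 'a" where
  "gradient h x = (THE D. GDERIV h x :> D)"

lemma gradient_eqI:
  assumes "GDERIV h x :> D"
  shows "gradient h x = D"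
  unfolding gradient_def
proof (rule the_equality)
  fix D' assume "GDERIV h x :> D'"
  with assms have "(\<lambda>v. inner v D') = (\<lambda>v. inner v D)"
    unfolding gderiv_def by (rule has_derivative_unique[rotated])
  then have "inner (D' - D) D' = inner (D' - D) D"
    by meson
  then have "inner (D' - D) (D' - D) = 0"
    by (simp add: inner_diff_right)
  then show "D' = D"
    by simp
qed (fact assms)

definition grad_fst :: "('a::real_inner \<times> 'b::real_inner \<Rightarrow> real) \<Rightarrow> 'a \<Rightarrow> 'b \<Rightarrow> 'a" where
  "grad_fst f \<theta> \<alpha> = gradient (\<lambda>\<theta>'. f (\<theta>', \<alpha>)) \<theta>"

definition grad_snd :: "('a::real_inner \<times> 'b::real_inner \<Rightarrow> real) \<Rightarrow> 'a \<Rightarrow> 'b \<Rightarrow> 'b" where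
  "grad_snd f \<theta> \<alpha> = gradient (\<lambda>\<alpha>'. f (\<theta>, \<alpha>')) \<alpha>"

text \<open>Joint twice continuous differentiability, via the first and second Frechet derivatives.
  Continuity of the first derivative follows from its differentiability.\<close>

definition twice_continuously_differentiable ::
    "('a::real_normed_vector \<Rightarrow> 'b::real_normed_vector) \<Rightarrow> bool" where
  "twice_continuously_differentiable f \<longleftrightarrow>
     (\<exists>(f' :: 'a \<Rightarrow> 'a \<Rightarrow>\<^sub>L 'b) (f'' :: 'a \<Rightarrow> 'a \<Rightarrow>\<^sub>L ('a \<Rightarrow>\<^sub>L 'b)).
        (\<forall>x. (f has_derivative blinfun_apply (f' x)) (at x)) \<and>
        (\<forall>x. (f' has_derivative blinfun_apply (f'' x)) (at x)) \<and>
        continuous_on UNIV f'')"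

definition lipschitz_gradients ::
    "real \<Rightarrow> real \<Rightarrow> real \<Rightarrow> ('a::real_inner \<times> 'b::real_inner \<Rightarrow> real) \<Rightarrow> bool" where
  "lipschitz_gradients L11 L12 L22 f \<longleftrightarrow>
     (\<forall>\<theta>1 \<theta>2 \<alpha>. norm (grad_fst f \<theta>1 \<alpha> - grad_fst f \<theta>2 \<alpha>) \<le> L11 * norm (\<theta>1 - \<theta>2)) \<and>
     (\<forall>\<theta> \<alpha>1 \<alpha>2. norm (grad_snd f \<theta> \<alpha>1 - grad_snd f \<theta> \<alpha>2) \<le> L22 * norm (\<alpha>1 - \<alpha>2)) \<and>
     (\<forall>\<theta>1 \<theta>2 \<alpha>. norm (grad_snd f \<theta>1 \<alpha> - grad_snd f \<theta>2 \<alpha>) \<le> L12 * norm (\<theta>1 - \<theta>2)) \<and>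
     (\<forall>\<theta> \<alpha>1 \<alpha>2. norm (grad_fst f \<theta> \<alpha>1 - grad_fst f \<theta> \<alpha>2) \<le> L12 * norm (\<alpha>1 - \<alpha>2))"

definition attains_min :: "('a \<Rightarrow> real) \<Rightarrow> bool" where
  "attains_min h \<longleftrightarrow> (\<exists>x. is_arg_min h (\<lambda>_. True) x)"

text \<open>Since the minimum is required to be attained, the infimum below is the minimum value.\<close>

definition PL :: "real \<Rightarrow> ('a::real_inner \<Rightarrow> real) \<Rightarrow> bool" where
  "PL \<mu> h \<longleftrightarrow>
     (\<forall>x. h differentiable (at x)) \<and> attains_min h \<and>
     (\<forall>x. 1/2 * (norm (gradient h x))\<^sup>2 \<ge> \<mu> * (h x - (INF y. h y)))"

definition PL_game :: "real \<Rightarrow> ('a \<times> 'b::real_inner \<Rightarrow> real) \<Rightarrow> bool" where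
  "PL_game \<mu> f \<longleftrightarrow> (\<forall>\<theta>. PL \<mu> (\<lambda>\<alpha>. - f (\<theta>, \<alpha>)))"

text \<open>In a PL-game the supremum is a maximum for every \<open>\<theta>\<close>.\<close>

definition max_value :: "('a \<times> 'b \<Rightarrow> real) \<Rightarrow> 'a \<Rightarrow> real" where
  "max_value f \<theta> = (SUP \<alpha>. f (\<theta>, \<alpha>))"

text \<open>\<open>inner_ascent f \<eta>1 \<theta> \<alpha> k\<close> is the \<open>k\<close>-th inner iterate at \<open>\<theta>\<close> started from \<open>\<alpha>\<close>.\<close>

primrec inner_ascent ::
    "('a::real_inner \<times> 'b::real_inner \<Rightarrow> real) \<Rightarrow> real \<Rightarrow> 'a \<Rightarrow> 'b \<Rightarrow> nat \<Rightarrow> 'b" where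
  "inner_ascent f \<eta>1 \<theta> \<alpha> 0 = \<alpha>"
| "inner_ascent f \<eta>1 \<theta> \<alpha> (Suc k) =
     inner_ascent f \<eta>1 \<theta> \<alpha> k + \<eta>1 *\<^sub>R grad_snd f \<theta> (inner_ascent f \<eta>1 \<theta> \<alpha> k)"

text \<open>The state after \<open>t\<close> outer steps is \<open>(\<theta>\<^sub>t, \<alpha>\<^sub>t)\<close>. The number \<open>T\<close> of outer steps does not
  influence the iterates, so it is not a parameter.\<close>

primrec multistep_gda ::
    "('a::real_inner \<times> 'b::real_inner \<Rightarrow> real) \<Rightarrow> nat \<Rightarrow> real \<Rightarrow> real \<Rightarrow> 'a \<Rightarrow> 'b \<Rightarrow> nat \<Rightarrow> 'a \<times> 'b" where
  "multistep_gda f K \<eta>1 \<eta>2 \<theta>0 \<alpha>0 0 = (\<theta>0, \<alpha>0)"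
| "multistep_gda f K \<eta>1 \<eta>2 \<theta>0 \<alpha>0 (Suc t) =
     (let (\<theta>, \<alpha>) = multistep_gda f K \<eta>1 \<eta>2 \<theta>0 \<alpha>0 t;
          \<alpha>' = inner_ascent f \<eta>1 \<theta> \<alpha> K
      in (\<theta> - \<eta>2 *\<^sub>R grad_fst f \<theta> \<alpha>', \<alpha>'))"

definition eps_stationary ::
    "real \<Rightarrow> ('a::real_inner \<times> 'b::real_inner \<Rightarrow> real) \<Rightarrow> 'a \<Rightarrow> 'b \<Rightarrow> bool" where
  "eps_stationary \<epsilon> f \<theta> \<alpha> \<longleftrightarrow>
     norm (grad_fst f \<theta> \<alpha>) \<le> \<epsilon> \<and> norm (grad_snd f \<theta> \<alpha>) \<le> \<epsilon>"

end

theory Submission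
  imports Defs
begin

text \<open>The multi-step ascent contracts the gap \<open>g \<theta> - f (\<theta>, \<alpha>)\<close> by \<open>\<rho>\<close> per inner step, and the PL condition
  yields quadratic growth, so \<open>\<alpha>\<close> ends near a maximizer and \<open>\<nabla>\<^sub>\<theta> f\<close> near \<open>\<nabla>g\<close>. Differentiability of
  \<open>g\<close> is never used as such: for a maximizer \<open>a\<close> at \<open>\<theta>\<close>, the vector \<open>\<nabla>\<^sub>\<theta> f (\<theta>, a)\<close> does not depend on
  the choice of \<open>a\<close>, and \<open>g\<close> satisfies the quadratic upper bound with this vector and constant \<open>L\<close>.
  If no iterate were stationary, each outer step would decrease \<open>g\<close> by more than \<open>\<epsilon>\<^sup>2 / (18 L)\<close>.\<close>

section \<open>Gradients of smooth functions\<close>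

text \<open>Riesz representation in finite dimension: the vector \<open>D\<close> collects the
  values of the derivative on an orthonormal basis.\<close>

lemma GDERIV_gradient:
  fixes h :: "'a::euclidean_space \<Rightarrow> real"
  assumes "h differentiable (at x)"
  shows "GDERIV h x :> gradient h x"
proof -
  obtain h' where h': "(h has_derivative h') (at x)"
    using assms by (auto simp: differentiable_def)
  define D where "D = (\<Sum>b\<in>Basis. h' b *\<^sub>R b)"
  have "h' v = inner v D" for v
  proof -
    have lin: "linear h'"
      using h' by (rule has_derivative_linear)
    have "h' v = h' (\<Sum>b\<in>Basis. (v \<bullet> b) *\<^sub>R b)"
      by (simp add: euclidean_representation)
    also have "\<dots> = (\<Sum>b\<in>Basis. (v \<bullet> b) * h' b)"
      by (simp add: linear_sum[OF lin] linear_scale[OF lin])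
    also have "\<dots> = inner v D"
      by (simp add: D_def inner_sum_right mult.commute)
    finally show ?thesis .
  qed
  then have "GDERIV h x :> D"
    using h' by (metis ext gderiv_def)
  then show ?thesis
    using gradient_eqI by metis
qed

lemma GDERIV_along_line:
  fixes h :: "'a::real_inner \<Rightarrow> real"
  assumes "GDERIV h (x + t *\<^sub>R d) :> D"
  shows "((\<lambda>s. h (x + s *\<^sub>R d)) has_real_derivative inner d D) (at t)"
proof -
  have "(h has_derivative (\<lambda>v. inner v D)) (at (x + t *\<^sub>R d))"
    using assms by (simp add: gderiv_def)
  moreover have "((\<lambda>s. x + s *\<^sub>R d) has_derivative (\<lambda>s. s *\<^sub>R d)) (at t)"
    by (auto intro!: derivative_eq_intros)
  ultimately have "((\<lambda>s. h (x + s *\<^sub>R d)) has_derivative (\<lambda>s. inner (s *\<^sub>R d) D)) (at t)"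
    by (rule has_derivative_compose[rotated])
  moreover have "(\<lambda>s. inner (s *\<^sub>R d) D) = (*) (inner d D)"
    by (auto simp: mult.commute)
  ultimately show ?thesis
    by (simp add: has_field_derivative_def)
qed

text \<open>Along the segment from \<open>x\<close> to \<open>y\<close>, the excess of
  \<open>h\<close> over its quadratic model is \<open>\<psi>\<close> up to a constant. Its
  derivative is nonpositive by Cauchy-Schwarz and the Lipschitz bound, so comparing
  \<open>t = 1\<close> with \<open>t = 0\<close> suffices.\<close>

lemma descent_lemma:
  fixes h :: "'a::real_inner \<Rightarrow> real"
  assumes grad: "\<And>x. GDERIV h x :> G x"
    and lip: "\<And>x y. norm (G x - G y) \<le> L * norm (x - y)"
  shows "h y \<le> h x + inner (G x) (y - x) + L / 2 * (norm (y - x))\<^sup>2"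
proof -
  define d where "d = y - x"
  define \<psi> where
    "\<psi> t = h (x + t *\<^sub>R d) - t * inner (G x) d - L / 2 * t\<^sup>2 * (norm d)\<^sup>2" for t
  define \<psi>' where
    "\<psi>' t = inner d (G (x + t *\<^sub>R d)) - inner (G x) d - L * t * (norm d)\<^sup>2" for t
  have "\<psi> 1 \<le> \<psi> 0"
  proof (rule DERIV_nonpos_imp_nonincreasing[of 0 1 \<psi>])
    fix t :: real assume t: "0 \<le> t" "t \<le> 1"
    have "(\<psi> has_real_derivative \<psi>' t) (at t)"
      unfolding \<psi>_def \<psi>'_def
      by (rule derivative_eq_intros GDERIV_along_line grad refl | simp)+
    moreover have "\<psi>' t \<le> 0"
    proof -
      have "inner d (G (x + t *\<^sub>R d)) - inner (G x) d = inner d (G (x + t *\<^sub>R d) - G x)"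
        by (simp add: inner_diff_right inner_commute)
      also have "\<dots> \<le> norm d * norm (G (x + t *\<^sub>R d) - G x)"
        by (rule norm_cauchy_schwarz)
      also have "\<dots> \<le> norm d * (L * norm (t *\<^sub>R d))"
        using lip[of "x + t *\<^sub>R d" x] by (intro mult_left_mono) auto
      also have "\<dots> = L * t * (norm d)\<^sup>2"
        using t by (simp add: power2_eq_square)
      finally show ?thesis by (simp add: \<psi>'_def)
    qed
    ultimately show "\<exists>z. (\<psi> has_real_derivative z) (at t) \<and> z \<le> 0"
      by blast
  qed simp
  then show ?thesis
    by (simp add: \<psi>_def d_def)
qed

lemma descent_gradient_step:
  fixes h :: "'a::real_inner \<Rightarrow> real"
  assumes "\<And>x. GDERIV h x :> G x"
    and "\<And>x y. norm (G x - G y) \<le> L * norm (x - y)"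
    and "L > 0"
  shows "h (x - (1 / L) *\<^sub>R G x) \<le> h x - (norm (G x))\<^sup>2 / (2 * L)"
proof -
  have "h (x - (1 / L) *\<^sub>R G x) \<le> h x - (norm (G x))\<^sup>2 / L + L / 2 * ((norm (G x))\<^sup>2 / L\<^sup>2)"
    using descent_lemma[of h G L, OF assms(1,2), of "x - (1 / L) *\<^sub>R G x" x] \<open>L > 0\<close>
    by (simp add: power2_norm_eq_inner power_divide)
  also have "\<dots> = h x - (norm (G x))\<^sup>2 / (2 * L)"
    using \<open>L > 0\<close> by (simp add: field_simps power2_eq_square)
  finally show ?thesis .
qed

section \<open>Error bounds from the PL condition\<close>

text \<open>Ekeland's argument: a minimizer of \<open>y \<mapsto> \<phi> y + c' * norm (y - x)\<close> with \<open>c' < c\<close> must be a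
  zero of \<open>\<phi>\<close>, since otherwise a step against the gradient of \<open>\<phi>\<close> would improve it.\<close>

lemma slope_error_bound_strict:
  fixes \<phi> :: "'a::euclidean_space \<Rightarrow> real"
  assumes cont: "continuous_on UNIV \<phi>" and nonneg: "\<And>y. \<phi> y \<ge> 0"
    and grad: "\<And>y. \<phi> y > 0 \<Longrightarrow> GDERIV \<phi> y :> G y"
    and slope: "\<And>y. \<phi> y > 0 \<Longrightarrow> norm (G y) \<ge> c"
    and c': "0 < c'" "c' < c"
  shows "\<exists>z. \<phi> z = 0 \<and> c' * norm (z - x) \<le> \<phi> x"
proof -
  define F where "F y = \<phi> y + c' * norm (y - x)" for y
  \<comment> \<open>Outside the ball of radius \<open>r\<close> the penalty alone exceeds
    \<open>F x\<close>, so a minimizer over this compact ball is a global one.\<close>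
  define r where "r = \<phi> x / c'"
  have contF: "continuous_on S F" for S
    unfolding F_def by (intro continuous_intros continuous_on_subset[OF cont]) auto
  have "cball x r \<noteq> {}"
    using divide_nonneg_pos[OF nonneg[of x] c'(1)] by (simp add: r_def)
  then obtain z where z: "z \<in> cball x r" "\<And>y. y \<in> cball x r \<Longrightarrow> F z \<le> F y"
    using continuous_attains_inf[OF compact_cball _ contF] by blast
  have zmin: "F z \<le> F y" for y
  proof (cases "y \<in> cball x r")
    case False
    then have "\<phi> x < c' * norm (y - x)"
      using c' by (simp add: r_def dist_norm norm_minus_commute field_simps)
    then have "F x \<le> F y"
      using nonneg[of y] by (simp add: F_def)
    moreover have "F z \<le> F x"
      using z(2)[of x] divide_nonneg_pos[OF nonneg[of x] c'(1)] by (simp add: r_def)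
    ultimately show ?thesis by simp
  qed (rule z(2))
  have "\<phi> z = 0"
  proof (rule ccontr)
    assume "\<phi> z \<noteq> 0"
    then have pos: "\<phi> z > 0"
      using nonneg[of z] by simp
    define D where "D = G z"
    have "c \<le> norm D"
      unfolding D_def by (rule slope[OF pos])
    define \<psi> where "\<psi> s = \<phi> (z + s *\<^sub>R (- D)) + c' * s * norm D" for s
    have "((\<lambda>s. \<phi> (z + s *\<^sub>R (- D))) has_real_derivative inner (- D) D) (at 0)"
      by (rule GDERIV_along_line) (use grad[OF pos] in \<open>simp add: D_def\<close>)
    then have "(\<psi> has_real_derivative inner (- D) D + c' * norm D) (at 0)"
      unfolding \<psi>_def by (auto intro!: derivative_eq_intros)
    moreover have "inner (- D) D + c' * norm D < 0"
    proof -
      have "c' * norm D < norm D * norm D"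
        using \<open>c \<le> norm D\<close> c' by (intro mult_strict_right_mono) auto
      then show ?thesis
        by (simp add: power2_norm_eq_inner[symmetric] power2_eq_square)
    qed
    ultimately obtain e where e: "e > 0" "\<And>s. 0 < s \<Longrightarrow> s < e \<Longrightarrow> \<psi> (0 + s) < \<psi> 0"
      using DERIV_neg_dec_right by blast
    define s where "s = e / 2"
    have s: "s > 0" "\<psi> s < \<psi> 0"
      using e(1) e(2)[of s] by (auto simp: s_def)
    have "norm (z + s *\<^sub>R (- D) - x) \<le> norm (z - x) + s * norm D"
      using norm_triangle_ineq[of "z - x" "s *\<^sub>R (- D)"] s(1) by (simp add: algebra_simps)
    then have "F (z + s *\<^sub>R (- D)) \<le> \<psi> s + c' * norm (z - x)"
      using c' unfolding F_def \<psi>_def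
      by (smt (verit, ccfv_SIG) distrib_left mult.assoc mult_left_mono)
    then have "F (z + s *\<^sub>R (- D)) < F z"
      using s(2) by (simp add: F_def \<psi>_def)
    then show False
      using zmin[of "z + s *\<^sub>R (- D)"] by simp
  qed
  moreover have "c' * norm (z - x) \<le> \<phi> x"
    using zmin[of x] \<open>\<phi> z = 0\<close> by (simp add: F_def)
  ultimately show ?thesis by blast
qed

text \<open>Removes the loss \<open>c' < c\<close>: the set of zeros is closed, so one fixed nearest
  zero serves for all \<open>c'\<close> at once.\<close>

lemma slope_error_bound:
  fixes \<phi> :: "'a::euclidean_space \<Rightarrow> real"
  assumes cont: "continuous_on UNIV \<phi>" and nonneg: "\<And>y. \<phi> y \<ge> 0"
    and grad: "\<And>y. \<phi> y > 0 \<Longrightarrow> GDERIV \<phi> y :> G y"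
    and slope: "\<And>y. \<phi> y > 0 \<Longrightarrow> norm (G y) \<ge> c"
    and "0 < c"
  shows "\<exists>z. \<phi> z = 0 \<and> c * norm (z - x) \<le> \<phi> x"
proof -
  define Z where "Z = {z. \<phi> z = 0}"
  have near: "\<exists>z\<in>Z. c' * norm (z - x) \<le> \<phi> x" if "0 < c'" "c' < c" for c'
    using slope_error_bound_strict[OF cont nonneg grad slope that] unfolding Z_def by auto
  have "closed Z"
    unfolding Z_def using cont by (intro closed_Collect_eq) auto
  moreover have "Z \<noteq> {}"
    using near[of "c / 2"] \<open>0 < c\<close> by auto
  ultimately obtain z where z: "z \<in> Z" "\<And>y. y \<in> Z \<Longrightarrow> dist x z \<le> dist x y"
    using distance_attains_inf by blast
  have "c * dist x z \<le> \<phi> x"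
  proof (rule ccontr)
    assume "\<not> ?thesis"
    then have less: "\<phi> x < c * dist x z" by simp
    then have "dist x z > 0"
      using nonneg[of x] \<open>0 < c\<close> by (smt (verit) zero_less_mult_pos)
    \<comment> \<open>If the bound failed, the ratio \<open>q\<close> would be below
      \<open>c\<close>; any \<open>c'\<close> strictly between them, here the midpoint, gives a zero
      closer than the nearest one.\<close>
    define q where "q = \<phi> x / dist x z"
    define c' where "c' = (c + q) / 2"
    have "q < c" "q \<ge> 0"
      using less \<open>dist x z > 0\<close> nonneg[of x] by (auto simp: q_def divide_simps mult.commute)
    then have c': "0 < c'" "c' < c" "q < c'"
      by (simp_all add: c'_def)
    obtain y where y: "y \<in> Z" "c' * norm (y - x) \<le> \<phi> x"
      using near[OF c'(1,2)] by blast
    have "c' * dist x z \<le> \<phi> x"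
      using z(2)[OF y(1)] y(2) c'(1)
      by (smt (verit) dist_norm mult_left_mono norm_minus_commute)
    then show False
      using c'(3) \<open>dist x z > 0\<close> by (simp add: q_def field_simps)
  qed
  then show ?thesis
    using z(1) by (auto simp: Z_def dist_norm norm_minus_commute)
qed

text \<open>Where \<open>\<phi> = sqrt (h - m)\<close> is positive, its gradient is
  \<open>G / (2 * \<phi>)\<close>, and PL says exactly that this has norm at least
  \<open>sqrt (\<mu> / 2)\<close>. The slope bound for \<open>\<phi>\<close>, squared, is the growth
  bound for \<open>h\<close>.\<close>

lemma PL_quadratic_growth:
  fixes h :: "'a::euclidean_space \<Rightarrow> real"
  assumes grad: "\<And>y. GDERIV h y :> G y"
    and lower: "\<And>y. m \<le> h y"
    and PL: "\<And>y. \<mu> * (h y - m) \<le> (norm (G y))\<^sup>2 / 2"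
    and "\<mu> > 0"
  shows "\<exists>z. h z = m \<and> \<mu> / 2 * (norm (z - x))\<^sup>2 \<le> h x - m"
proof -
  define \<phi> where "\<phi> y = sqrt (h y - m)" for y
  have "continuous_on UNIV h"
    using has_derivative_continuous grad[unfolded gderiv_def]
    by (blast intro: continuous_at_imp_continuous_on)
  then have cont: "continuous_on UNIV \<phi>"
    unfolding \<phi>_def by (intro continuous_intros)
  have "\<exists>z. \<phi> z = 0 \<and> sqrt (\<mu> / 2) * norm (z - x) \<le> \<phi> x"
  proof (rule slope_error_bound[OF cont])
    show "\<phi> y \<ge> 0" for y
      using lower[of y] by (simp add: \<phi>_def)
    fix y assume "\<phi> y > 0"
    then have pos: "h y - m > 0"
      by (simp add: \<phi>_def)
    have "DERIV sqrt (h y - m) :> inverse (sqrt (h y - m)) / 2"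
      using pos by (rule DERIV_real_sqrt)
    moreover have "GDERIV (\<lambda>y. h y - m) y :> G y"
      using GDERIV_diff[OF grad[of y] GDERIV_const[of m]] by simp
    ultimately show "GDERIV \<phi> y :> (inverse (sqrt (h y - m)) / 2) *\<^sub>R G y"
      unfolding \<phi>_def using GDERIV_DERIV_compose by blast
    define p where "p = h y - m"
    have "(sqrt (\<mu> / 2) * (2 * sqrt p))\<^sup>2 = 2 * (\<mu> * p)"
      using pos \<open>\<mu> > 0\<close> by (simp add: power_mult_distrib p_def[symmetric])
    also have "\<dots> \<le> (norm (G y))\<^sup>2"
      using PL[of y] by (simp add: p_def)
    finally have "sqrt (\<mu> / 2) * (2 * sqrt (h y - m)) \<le> norm (G y)"
      unfolding p_def by (rule power2_le_imp_le) simp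
    then have "sqrt (\<mu> / 2) \<le> norm (G y) / (2 * sqrt (h y - m))"
      using pos by (simp add: pos_le_divide_eq)
    then show "sqrt (\<mu> / 2) \<le> norm ((inverse (sqrt (h y - m)) / 2) *\<^sub>R G y)"
      using pos by (simp add: inverse_eq_divide)
  qed (use \<open>\<mu> > 0\<close> in auto)
  then obtain z where z: "\<phi> z = 0" "sqrt (\<mu> / 2) * norm (z - x) \<le> \<phi> x"
    by blast
  have "(sqrt (\<mu> / 2) * norm (z - x))\<^sup>2 \<le> (\<phi> x)\<^sup>2"
    using z(2) \<open>\<mu> > 0\<close> by (intro power_mono) auto
  then have "\<mu> / 2 * (norm (z - x))\<^sup>2 \<le> h x - m"
    using lower[of x] \<open>\<mu> > 0\<close> by (simp add: \<phi>_def power_mult_distrib)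
  moreover have "h z = m"
    using z(1) by (simp add: \<phi>_def)
  ultimately show ?thesis by blast
qed

section \<open>Smooth PL games\<close>

text \<open>The gradients and the maximum are abstract functions here, so that the estimates do not
  mention \<open>gradient\<close> or a supremum. \<open>g\<close> enters as an upper bound
  satisfying the PL inequality; \<open>maximizer_near\<close> derives that it is attained.\<close>

locale smooth_PL_game =
  fixes f :: "'a::real_inner \<times> 'b::euclidean_space \<Rightarrow> real"
    and A :: "'a \<Rightarrow> 'b \<Rightarrow> 'a" and B :: "'a \<Rightarrow> 'b \<Rightarrow> 'b"
    and g :: "'a \<Rightarrow> real"
    and L11 L12 L22 \<mu> :: real
  assumes grad_A: "GDERIV (\<lambda>\<theta>'. f (\<theta>', \<alpha>)) \<theta> :> A \<theta> \<alpha>"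
    and grad_B: "GDERIV (\<lambda>\<alpha>'. f (\<theta>, \<alpha>')) \<alpha> :> B \<theta> \<alpha>"
    and lip_A1: "norm (A \<theta>1 \<alpha> - A \<theta>2 \<alpha>) \<le> L11 * norm (\<theta>1 - \<theta>2)"
    and lip_A2: "norm (A \<theta> \<alpha>1 - A \<theta> \<alpha>2) \<le> L12 * norm (\<alpha>1 - \<alpha>2)"
    and lip_B1: "norm (B \<theta>1 \<alpha> - B \<theta>2 \<alpha>) \<le> L12 * norm (\<theta>1 - \<theta>2)"
    and lip_B2: "norm (B \<theta> \<alpha>1 - B \<theta> \<alpha>2) \<le> L22 * norm (\<alpha>1 - \<alpha>2)"
    and L_pos: "L11 > 0" "L12 > 0" "L22 > 0" and \<mu>_pos: "\<mu> > 0"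
    and le_g: "f (\<theta>, \<alpha>) \<le> g \<theta>"
    and PL_B: "\<mu> * (g \<theta> - f (\<theta>, \<alpha>)) \<le> (norm (B \<theta> \<alpha>))\<^sup>2 / 2"
begin

text \<open>The smoothness constant of \<open>g\<close> in \<open>g_upper_bound\<close>: the second
  summand accounts for the motion of the maximizer with \<open>\<theta>\<close>.\<close>

definition L :: real where
  "L = L11 + L12\<^sup>2 / \<mu>"

lemma L_gt_0: "L > 0"
  using L_pos \<mu>_pos by (simp add: L_def add_pos_nonneg)

lemma grad_neg_B: "GDERIV (\<lambda>\<alpha>'. - f (\<theta>, \<alpha>')) \<alpha> :> - B \<theta> \<alpha>"
  by (rule GDERIV_minus[OF grad_B])

section \<open>Ascent and maximizers in the second variable\<close>

lemma ascent_step: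
  "f (\<theta>, \<alpha> + (1 / L22) *\<^sub>R B \<theta> \<alpha>) \<ge> f (\<theta>, \<alpha>) + (norm (B \<theta> \<alpha>))\<^sup>2 / (2 * L22)"
  using descent_gradient_step[of "\<lambda>\<alpha>'. - f (\<theta>, \<alpha>')" "\<lambda>\<alpha>'. - B \<theta> \<alpha>'" L22, OF grad_neg_B _ L_pos(3), of \<alpha>]
    lip_B2[of \<theta>] by (simp add: norm_minus_commute)

text \<open>The gain of one ascent step cannot exceed the gap, since \<open>f\<close> stays below
  \<open>g\<close>.\<close>

lemma norm_B_le_gap: "(norm (B \<theta> \<alpha>))\<^sup>2 \<le> 2 * L22 * (g \<theta> - f (\<theta>, \<alpha>))"
  using order_trans[OF ascent_step[of \<theta> \<alpha>] le_g] L_pos(3) by (simp add: field_simps)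

text \<open>PL bounds the gain of an ascent step below by a fixed fraction of the gap.\<close>

lemma gap_ascent_step:
  "g \<theta> - f (\<theta>, \<alpha> + (1 / L22) *\<^sub>R B \<theta> \<alpha>) \<le> (1 - \<mu> / L22) * (g \<theta> - f (\<theta>, \<alpha>))"
proof -
  have "\<mu> * (g \<theta> - f (\<theta>, \<alpha>)) / L22 \<le> (norm (B \<theta> \<alpha>))\<^sup>2 / 2 / L22"
    using PL_B L_pos(3) by (intro divide_right_mono) auto
  then show ?thesis
    using ascent_step[of \<theta> \<alpha>] by (simp add: left_diff_distrib)
qed

lemma maximizer_near:
  "\<exists>a. f (\<theta>, a) = g \<theta> \<and> \<mu> / 2 * (norm (a - \<alpha>))\<^sup>2 \<le> g \<theta> - f (\<theta>, \<alpha>)"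
  using PL_quadratic_growth[of "\<lambda>\<alpha>'. - f (\<theta>, \<alpha>')" "\<lambda>\<alpha>'. - B \<theta> \<alpha>'" "- g \<theta>" \<mu> \<alpha>, OF grad_neg_B]
    le_g PL_B \<mu>_pos by (simp add: algebra_simps)

lemma B_maximizer:
  assumes "f (\<theta>, a) = g \<theta>"
  shows "B \<theta> a = 0"
  using norm_B_le_gap[of \<theta> a] assms by simp

text \<open>The gradient \<open>B\<close> vanishes at \<open>a\<close> for \<open>\<theta>\<close>,
  hence is at most \<open>L12 * norm (\<theta>' - \<theta>)\<close> for \<open>\<theta>'\<close>. PL
  turns this into a small gap of \<open>a\<close> at \<open>\<theta>'\<close>, and quadratic growth
  turns the gap into a distance.\<close>

lemma maximizer_near_maximizer:
  assumes "f (\<theta>, a) = g \<theta>"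
  shows "\<exists>a'. f (\<theta>', a') = g \<theta>' \<and> norm (a' - a) \<le> L12 / \<mu> * norm (\<theta>' - \<theta>)"
proof -
  obtain a' where a': "f (\<theta>', a') = g \<theta>'" "\<mu> / 2 * (norm (a' - a))\<^sup>2 \<le> g \<theta>' - f (\<theta>', a)"
    using maximizer_near by blast
  have "(\<mu> * norm (a' - a))\<^sup>2 = 2 * \<mu> * (\<mu> / 2 * (norm (a' - a))\<^sup>2)"
    by (simp add: power2_eq_square)
  also have "\<dots> \<le> 2 * \<mu> * (g \<theta>' - f (\<theta>', a))"
    using a'(2) \<mu>_pos by (intro mult_left_mono) auto
  also have "\<dots> \<le> (norm (B \<theta>' a))\<^sup>2"
    using PL_B[of \<theta>' a] by simp
  also have "\<dots> \<le> (L12 * norm (\<theta>' - \<theta>))\<^sup>2"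
    using lip_B1[of \<theta>' a \<theta>] B_maximizer[OF assms] by (intro power_mono) auto
  finally have "\<mu> * norm (a' - a) \<le> L12 * norm (\<theta>' - \<theta>)"
    by (rule power2_le_imp_le) (use L_pos in simp)
  then show ?thesis
    using a'(1) \<mu>_pos by (auto simp: field_simps)
qed

section \<open>Smoothness and descent of the maximum function\<close>

lemma upper_bound_fst:
  "f (\<theta>', \<alpha>) \<le> f (\<theta>, \<alpha>) + inner (A \<theta> \<alpha>) (\<theta>' - \<theta>) + L11 / 2 * (norm (\<theta>' - \<theta>))\<^sup>2"
  by (rule descent_lemma[of "\<lambda>\<theta>'. f (\<theta>', \<alpha>)" "\<lambda>\<theta>'. A \<theta>' \<alpha>", OF grad_A lip_A1])

lemma lower_bound_fst:
  "f (\<theta>', \<alpha>) \<ge> f (\<theta>, \<alpha>) + inner (A \<theta> \<alpha>) (\<theta>' - \<theta>) - L11 / 2 * (norm (\<theta>' - \<theta>))\<^sup>2"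
  using descent_lemma[of "\<lambda>\<theta>'. - f (\<theta>', \<alpha>)" "\<lambda>\<theta>'. - A \<theta>' \<alpha>" L11, OF GDERIV_minus[OF grad_A], of \<theta>' \<theta>]
    lip_A1[of _ \<alpha>] by (simp add: norm_minus_commute)

text \<open>To first order in \<open>d\<close>, \<open>g (\<theta> + d) - g \<theta>\<close> is at most \<open>inner (A \<theta> a) d\<close>, because a maximizer at
  \<open>\<theta> + d\<close> lies close to \<open>a\<close>, and at least \<open>inner (A \<theta> b) d\<close>.\<close>

lemma A_maximizers_eq:
  assumes a: "f (\<theta>, a) = g \<theta>" and b: "f (\<theta>, b) = g \<theta>"
  shows "A \<theta> a = A \<theta> b"
proof -
  have bound: "inner (A \<theta> b - A \<theta> a) d \<le> L * (norm d)\<^sup>2" for d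
  proof -
    obtain a' where a': "f (\<theta> + d, a') = g (\<theta> + d)" "norm (a' - a) \<le> L12 / \<mu> * norm d"
      using maximizer_near_maximizer[OF a, of "\<theta> + d"] by auto
    have "norm (A \<theta> a' - A \<theta> a) \<le> L12 * (L12 / \<mu> * norm d)"
      using lip_A2[of \<theta> a' a] a'(2) L_pos(2) by (smt (verit) mult_left_mono)
    then have "inner (A \<theta> a' - A \<theta> a) d \<le> L12 * (L12 / \<mu> * norm d) * norm d"
      by (meson norm_cauchy_schwarz norm_ge_zero mult_right_mono order_trans)
    also have "\<dots> = L12\<^sup>2 / \<mu> * (norm d)\<^sup>2"
      by (simp add: power2_eq_square)
    finally have "inner (A \<theta> a') d \<le> inner (A \<theta> a) d + L12\<^sup>2 / \<mu> * (norm d)\<^sup>2"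
      by (simp add: inner_diff_left)
    moreover have "g (\<theta> + d) \<le> g \<theta> + inner (A \<theta> a') d + L11 / 2 * (norm d)\<^sup>2"
      using upper_bound_fst[of "\<theta> + d" a' \<theta>] a'(1) le_g[of \<theta> a'] by simp
    moreover have "g (\<theta> + d) \<ge> g \<theta> + inner (A \<theta> b) d - L11 / 2 * (norm d)\<^sup>2"
      using lower_bound_fst[of \<theta> b "\<theta> + d"] b le_g[of "\<theta> + d" b] by simp
    ultimately show ?thesis
      by (simp add: L_def inner_diff_left algebra_simps)
  qed
  define v where "v = A \<theta> b - A \<theta> a"
  \<comment> \<open>With \<open>d\<close> a multiple of \<open>v\<close>, the left side of
    \<open>bound\<close> is linear in the factor and the right side quadratic; the factor
    \<open>1 / (2 * L)\<close> is small enough to force \<open>v = 0\<close>.\<close>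
  have "(1 / (2 * L)) * (norm v)\<^sup>2 \<le> L * ((1 / (2 * L))\<^sup>2 * (norm v)\<^sup>2)"
    using bound[of "(1 / (2 * L)) *\<^sub>R v"] L_gt_0
    by (simp add: v_def[symmetric] dot_square_norm power_divide)
  also have "\<dots> = (1 / (4 * L)) * (norm v)\<^sup>2"
    using L_gt_0 by (simp add: field_simps power2_eq_square)
  finally have "(norm v)\<^sup>2 \<le> 0"
    using L_gt_0 by (simp add: field_simps)
  then show ?thesis
    by (simp add: v_def)
qed

text \<open>The upper bound for \<open>f\<close> is expanded at a maximizer \<open>a'\<close> of the
  new point \<open>\<theta>'\<close>. Replacing \<open>A \<theta> a'\<close> by
  \<open>A \<theta> a\<close> costs a term in the distance from \<open>a'\<close> to a maximizer at
  \<open>\<theta>\<close>; the deficit \<open>g \<theta> - f (\<theta>, a')\<close> pays for it by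
  quadratic growth.\<close>

lemma g_upper_bound:
  assumes a: "f (\<theta>, a) = g \<theta>"
  shows "g \<theta>' \<le> g \<theta> + inner (A \<theta> a) (\<theta>' - \<theta>) + L / 2 * (norm (\<theta>' - \<theta>))\<^sup>2"
proof -
  define d where "d = \<theta>' - \<theta>"
  obtain a' where a': "f (\<theta>', a') = g \<theta>'"
    using maximizer_near by blast
  obtain b where b: "f (\<theta>, b) = g \<theta>" "\<mu> / 2 * (norm (b - a'))\<^sup>2 \<le> g \<theta> - f (\<theta>, a')"
    using maximizer_near by blast
  define r where "r = norm (b - a')"
  have "norm (A \<theta> a' - A \<theta> a) \<le> L12 * r"
    using lip_A2[of \<theta> a' b] A_maximizers_eq[OF a b(1)] by (simp add: r_def norm_minus_commute)
  then have "inner (A \<theta> a' - A \<theta> a) d \<le> L12 * r * norm d"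
    by (meson norm_cauchy_schwarz norm_ge_zero mult_right_mono order_trans)
  also have "\<dots> \<le> \<mu> / 2 * r\<^sup>2 + L12\<^sup>2 / \<mu> / 2 * (norm d)\<^sup>2"
  proof -
    \<comment> \<open>Young's inequality, weighted so that the \<open>r\<close> term is exactly the
      one that the deficit absorbs.\<close>
    have "0 \<le> (\<mu> * r - L12 * norm d)\<^sup>2 / (2 * \<mu>)"
      using \<mu>_pos by simp
    also have "\<dots> = \<mu> / 2 * r\<^sup>2 + L12\<^sup>2 / \<mu> / 2 * (norm d)\<^sup>2 - L12 * r * norm d"
      using \<mu>_pos by (simp add: field_simps power2_eq_square)
    finally show ?thesis by simp
  qed
  finally have "inner (A \<theta> a') d \<le> inner (A \<theta> a) d + (g \<theta> - f (\<theta>, a')) + L12\<^sup>2 / \<mu> / 2 * (norm d)\<^sup>2"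
    using b(2) by (simp add: inner_diff_left r_def)
  then show ?thesis
    using upper_bound_fst[of \<theta>' a' \<theta>] a' unfolding d_def[symmetric]
    by (simp add: L_def algebra_simps add_divide_distrib)
qed

text \<open>A gradient step for \<open>g\<close> with inexact gradient \<open>x\<close> in place of
  \<open>y\<close>. The error \<open>norm (x - y)\<close> is controlled by the distance from
  \<open>\<alpha>\<close> to a maximizer, hence by the gap.\<close>

lemma g_outer_step:
  "g (\<theta> - (1 / L) *\<^sub>R A \<theta> \<alpha>)
     \<le> g \<theta> - (norm (A \<theta> \<alpha>))\<^sup>2 / (4 * L) + 2 * L12\<^sup>2 / (\<mu> * L) * (g \<theta> - f (\<theta>, \<alpha>))"
proof -
  obtain a where a: "f (\<theta>, a) = g \<theta>" "\<mu> / 2 * (norm (a - \<alpha>))\<^sup>2 \<le> g \<theta> - f (\<theta>, \<alpha>)"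
    using maximizer_near by blast
  define x where "x = A \<theta> \<alpha>"
  define y where "y = A \<theta> a"
  have "(norm (x - y))\<^sup>2 \<le> (L12 * norm (a - \<alpha>))\<^sup>2"
    using lip_A2[of \<theta> \<alpha> a] by (intro power_mono) (auto simp: x_def y_def norm_minus_commute)
  also have "\<dots> = 2 * L12\<^sup>2 / \<mu> * (\<mu> / 2 * (norm (a - \<alpha>))\<^sup>2)"
    using \<mu>_pos by (simp add: power_mult_distrib)
  also have "\<dots> \<le> 2 * L12\<^sup>2 / \<mu> * (g \<theta> - f (\<theta>, \<alpha>))"
    using a(2) \<mu>_pos by (intro mult_left_mono) auto
  finally have err: "(norm (x - y))\<^sup>2 / L \<le> 2 * L12\<^sup>2 / (\<mu> * L) * (g \<theta> - f (\<theta>, \<alpha>))"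
    using divide_right_mono[of "(norm (x - y))\<^sup>2" _ L] L_gt_0 by fastforce
  have "g (\<theta> - (1 / L) *\<^sub>R x) \<le> g \<theta> - inner y x / L + L / 2 * ((norm x)\<^sup>2 / L\<^sup>2)"
    using g_upper_bound[OF a(1), of "\<theta> - (1 / L) *\<^sub>R x"] L_gt_0
    by (simp add: y_def power_divide)
  also have "\<dots> = g \<theta> - (2 * inner y x - (norm x)\<^sup>2) / (2 * L)"
    using L_gt_0 by (simp add: field_simps power2_eq_square)
  also have "\<dots> \<le> g \<theta> - ((norm x)\<^sup>2 / 2 - 2 * (norm (x - y))\<^sup>2) / (2 * L)"
  proof -
    \<comment> \<open>Half of this square is the difference of the two sides of the next
      inequality.\<close>
    have "0 \<le> (norm (2 *\<^sub>R y - x))\<^sup>2" by simp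
    then have "(norm x)\<^sup>2 / 2 - 2 * (norm (x - y))\<^sup>2 \<le> 2 * inner y x - (norm x)\<^sup>2"
      unfolding power2_norm_eq_inner
      by (simp add: inner_diff_left inner_diff_right inner_commute)
    then show ?thesis
      using L_gt_0 by (intro diff_left_mono divide_right_mono) auto
  qed
  also have "\<dots> = g \<theta> - (norm x)\<^sup>2 / (4 * L) + (norm (x - y))\<^sup>2 / L"
    using L_gt_0 by (simp add: field_simps)
  finally show ?thesis
    using err by (simp add: x_def)
qed

end

section \<open>From PL-games to the abstract setting\<close>

lemma smooth_PL_game_twice_continuously_differentiable:
  fixes f :: "'a::euclidean_space \<times> 'b::euclidean_space \<Rightarrow> real"
  assumes "twice_continuously_differentiable f" and "lipschitz_gradients L11 L12 L22 f"
    and "PL_game \<mu> f" and "L11 > 0" "L12 > 0" "L22 > 0" "\<mu> > 0"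
  shows "smooth_PL_game f (grad_fst f) (grad_snd f) (max_value f) L11 L12 L22 \<mu>"
proof -
  obtain f' :: "'a \<times> 'b \<Rightarrow> ('a \<times> 'b) \<Rightarrow>\<^sub>L real"
    where f': "\<And>x. (f has_derivative blinfun_apply (f' x)) (at x)"
    using assms(1) unfolding twice_continuously_differentiable_def by blast
  have PL: "PL \<mu> (\<lambda>\<alpha>. - f (\<theta>, \<alpha>))" for \<theta>
    using assms(3) by (simp add: PL_game_def)
  have max: "\<exists>a. (\<forall>\<alpha>. f (\<theta>, \<alpha>) \<le> f (\<theta>, a)) \<and> max_value f \<theta> = f (\<theta>, a)
      \<and> (INF \<alpha>. - f (\<theta>, \<alpha>)) = - f (\<theta>, a)" for \<theta>
  proof -
    obtain a where a: "\<And>\<alpha>. f (\<theta>, \<alpha>) \<le> f (\<theta>, a)"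
      using PL[of \<theta>] by (auto simp: PL_def attains_min_def is_arg_min_def not_less)
    have "max_value f \<theta> = f (\<theta>, a)"
      unfolding max_value_def using a by (intro cSup_eq_maximum) auto
    moreover have "(INF \<alpha>. - f (\<theta>, \<alpha>)) = - f (\<theta>, a)"
      using a by (intro cInf_eq_minimum) auto
    ultimately show ?thesis
      using a by blast
  qed
  have A: "GDERIV (\<lambda>\<theta>'. f (\<theta>', \<alpha>)) \<theta> :> grad_fst f \<theta> \<alpha>" for \<theta> \<alpha>
  proof -
    have "((\<lambda>\<theta>'. (\<theta>', \<alpha>)) has_derivative (\<lambda>v. (v, 0))) (at \<theta>)"
      by (auto intro!: derivative_eq_intros)
    then have "(\<lambda>\<theta>'. f (\<theta>', \<alpha>)) differentiable (at \<theta>)"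
      using has_derivative_compose f' differentiableI by blast
    then show ?thesis
      unfolding grad_fst_def by (rule GDERIV_gradient)
  qed
  have B: "GDERIV (\<lambda>\<alpha>'. f (\<theta>, \<alpha>')) \<alpha> :> grad_snd f \<theta> \<alpha>" for \<theta> \<alpha>
  proof -
    have "((\<lambda>\<alpha>'. (\<theta>, \<alpha>')) has_derivative (\<lambda>v. (0, v))) (at \<alpha>)"
      by (auto intro!: derivative_eq_intros)
    then have "(\<lambda>\<alpha>'. f (\<theta>, \<alpha>')) differentiable (at \<alpha>)"
      using has_derivative_compose f' differentiableI by blast
    then show ?thesis
      unfolding grad_snd_def by (rule GDERIV_gradient)
  qed
  have "gradient (\<lambda>\<alpha>'. - f (\<theta>, \<alpha>')) \<alpha> = - grad_snd f \<theta> \<alpha>" for \<theta> \<alpha>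
    by (rule gradient_eqI[OF GDERIV_minus[OF B]])
  then have "\<mu> * (max_value f \<theta> - f (\<theta>, \<alpha>)) \<le> (norm (grad_snd f \<theta> \<alpha>))\<^sup>2 / 2" for \<theta> \<alpha>
    using PL[of \<theta>] max[of \<theta>] by (auto simp: PL_def algebra_simps)
  moreover have "f (\<theta>, \<alpha>) \<le> max_value f \<theta>" for \<theta> \<alpha>
    using max[of \<theta>] by auto
  ultimately show ?thesis
    using assms A B unfolding smooth_PL_game_def lipschitz_gradients_def by auto
qed

section \<open>Convergence of the algorithm\<close>

text \<open>Iterates \<open>gap_ascent_step\<close>; \<open>\<mu> \<le> L22\<close> makes the
  contraction factor nonnegative, so the induction hypothesis can be multiplied by it.\<close>

lemma gap_inner_ascent:
  assumes "smooth_PL_game f A (grad_snd f) g L11 L12 L22 \<mu>" and "\<mu> \<le> L22"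
  shows "g \<theta> - f (\<theta>, inner_ascent f (1 / L22) \<theta> \<alpha> k) \<le> (1 - \<mu> / L22) ^ k * (g \<theta> - f (\<theta>, \<alpha>))"
proof (induction k)
  case (Suc k)
  interpret smooth_PL_game f A "grad_snd f" g L11 L12 L22 \<mu> by fact
  have "0 \<le> 1 - \<mu> / L22"
    using assms(2) L_pos(3) by simp
  then have "(1 - \<mu> / L22) * (g \<theta> - f (\<theta>, inner_ascent f (1 / L22) \<theta> \<alpha> k))
      \<le> (1 - \<mu> / L22) * ((1 - \<mu> / L22) ^ k * (g \<theta> - f (\<theta>, \<alpha>)))"
    by (intro mult_left_mono Suc.IH)
  then show ?case
    using gap_ascent_step[of \<theta> "inner_ascent f (1 / L22) \<theta> \<alpha> k"] by (simp add: mult.assoc)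
qed simp

lemma power_mult_le_of_log_bound:
  fixes \<rho> c \<epsilon> :: real
  assumes "0 < \<rho>" "\<rho> < 1" "c > 0" "\<epsilon> > 0"
    and "real K \<ge> (2 * ln (1 / \<epsilon>) + ln c) / ln (1 / \<rho>)"
  shows "c * \<rho> ^ K \<le> \<epsilon>\<^sup>2"
proof -
  have "2 * ln (1 / \<epsilon>) + ln c \<le> real K * ln (1 / \<rho>)"
    using assms by (simp add: field_simps)
  then have "ln c + real K * ln \<rho> \<le> 2 * ln \<epsilon>"
    using assms by (simp add: ln_div)
  then have "ln (c * \<rho> ^ K) \<le> ln (\<epsilon>\<^sup>2)"
    using assms by (simp add: ln_mult ln_realpow)
  then show ?thesis
    using assms by simp
qed

lemma telescope_decrease:
  fixes u :: "nat \<Rightarrow> real"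
  assumes "\<And>t. t < T \<Longrightarrow> u (Suc t) \<le> u t - c"
  shows "u T \<le> u 0 - real T * c"
  using assms
proof (induction T)
  case (Suc T)
  then have "u T \<le> u 0 - real T * c" and "u (Suc T) \<le> u T - c"
    by auto
  then show ?case
    by (simp add: algebra_simps)
qed simp

theorem theorem3p2:
  fixes f :: "(real ^ 'n) \<times> (real ^ 'm) \<Rightarrow> real"
    and g :: "real ^ 'n \<Rightarrow> real"
    and \<theta> :: "nat \<Rightarrow> real ^ 'n" and \<alpha> :: "nat \<Rightarrow> real ^ 'm"
    and \<theta>0 :: "real ^ 'n" and \<alpha>0 :: "real ^ 'm"
    and L11 L12 L22 \<mu> L Lbar \<Delta>g \<kappa> \<rho> \<epsilon> \<Delta> \<eta>1 \<eta>2 :: real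
    and K T :: nat
  assumes "twice_continuously_differentiable f"
    and "L11 > 0" and "L12 > 0" and "L22 > 0"
    and "lipschitz_gradients L11 L12 L22 f"
    and "\<mu> > 0" and "PL_game \<mu> f"
    and g_eq: "g = max_value f"
    and "attains_min g"
    and L_eq: "L = L11 + L12\<^sup>2 / \<mu>"
    and Lbar_eq: "Lbar = max L12 L22"
    and \<Delta>g_eq: "\<Delta>g = g \<theta>0 - (INF \<theta>'. g \<theta>')"
    and \<kappa>_eq: "\<kappa> = L22 / \<mu>" and "\<kappa> \<ge> 1"
    and \<rho>_eq: "\<rho> = 1 - 1 / \<kappa>"
    and "\<epsilon> > 0" and "\<Delta> > 0"
    and \<eta>1_eq: "\<eta>1 = 1 / L22" and \<eta>2_eq: "\<eta>2 = 1 / L"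
    and "K > 0" and "T > 0"
    and K_bound: "if \<rho> = 0
      then 16 * (Lbar\<^sup>2 * \<Delta> / \<mu>) * \<rho> ^ K \<le> \<epsilon>\<^sup>2
      else real K \<ge> (2 * ln (1 / \<epsilon>) + ln (16 * Lbar\<^sup>2 * \<Delta> / \<mu>)) / ln (1 / \<rho>)"
    and T_bound: "real T \<ge> 18 * L * \<Delta>g / \<epsilon>\<^sup>2"
    and iterates: "\<And>t. (\<theta> t, \<alpha> t) = multistep_gda f K \<eta>1 \<eta>2 \<theta>0 \<alpha>0 t"
    and gap: "\<And>t. t < T \<Longrightarrow> g (\<theta> t) - f (\<theta> t, \<alpha> t) \<le> \<Delta>"
  shows "\<exists>t<T. eps_stationary \<epsilon> f (\<theta> t) (\<alpha> (Suc t))"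
proof -
  interpret G: smooth_PL_game f "grad_fst f" "grad_snd f" g L11 L12 L22 \<mu>
    unfolding g_eq using assms(1-7) by (intro smooth_PL_game_twice_continuously_differentiable)
  have L: "G.L = L" "L > 0"
    using G.L_gt_0 by (simp_all add: G.L_def L_eq)
  have "\<mu> \<le> L22"
    using \<open>\<kappa> \<ge> 1\<close> \<open>\<mu> > 0\<close> by (simp add: \<kappa>_eq)
  have \<rho>: "\<rho> = 1 - \<mu> / L22" "0 \<le> \<rho>" "\<rho> < 1"
    using \<open>\<mu> \<le> L22\<close> \<open>L22 > 0\<close> \<open>\<mu> > 0\<close> by (simp_all add: \<rho>_eq \<kappa>_eq)
  have Lbar: "Lbar \<ge> L12" "Lbar \<ge> L22" "Lbar > 0"
    using \<open>L12 > 0\<close> by (auto simp: Lbar_eq)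
  \<comment> \<open>The logarithmic condition is brought back to product form. For
    \<open>\<rho> = 0\<close> the power vanishes because \<open>K\<close> is positive.\<close>
  have K: "16 * Lbar\<^sup>2 * \<Delta> / \<mu> * \<rho> ^ K \<le> \<epsilon>\<^sup>2"
  proof (cases "\<rho> = 0")
    case False
    then have "0 < \<rho>"
      using \<rho>(2) by simp
    then show ?thesis
      using K_bound \<rho>(3) Lbar(3) \<open>\<Delta> > 0\<close> \<open>\<mu> > 0\<close> \<open>\<epsilon> > 0\<close>
      by (intro power_mult_le_of_log_bound) auto
  qed (use \<open>K > 0\<close> in \<open>simp add: zero_power\<close>)
  have \<alpha>_Suc: "\<alpha> (Suc t) = inner_ascent f (1 / L22) (\<theta> t) (\<alpha> t) K"
    and \<theta>_Suc: "\<theta> (Suc t) = \<theta> t - (1 / L) *\<^sub>R grad_fst f (\<theta> t) (\<alpha> (Suc t))" for t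
    using iterates[of "Suc t"] unfolding multistep_gda.simps iterates[of t, symmetric]
    by (simp_all add: Let_def \<eta>1_eq \<eta>2_eq)
  \<comment> \<open>The gap after the inner loop but before the update of
    \<open>\<theta>\<close>.\<close>
  define \<delta> where "\<delta> t = g (\<theta> t) - f (\<theta> t, \<alpha> (Suc t))" for t
  have gap_Suc: "16 * Lbar\<^sup>2 / \<mu> * \<delta> t \<le> \<epsilon>\<^sup>2" if "t < T" for t
  proof -
    have "\<delta> t \<le> \<rho> ^ K * (g (\<theta> t) - f (\<theta> t, \<alpha> t))"
      unfolding \<delta>_def \<alpha>_Suc \<rho>(1)
      by (rule gap_inner_ascent[OF G.smooth_PL_game_axioms \<open>\<mu> \<le> L22\<close>])
    also have "\<dots> \<le> \<rho> ^ K * \<Delta>"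
      using gap[OF that] \<rho>(2) by (intro mult_left_mono) auto
    finally have "16 * Lbar\<^sup>2 / \<mu> * \<delta> t \<le> 16 * Lbar\<^sup>2 / \<mu> * (\<rho> ^ K * \<Delta>)"
      using \<open>\<mu> > 0\<close> by (intro mult_left_mono) auto
    then show ?thesis
      using K by (simp add: mult_ac)
  qed
  have \<delta>_nonneg: "\<delta> t \<ge> 0" for t
    using G.le_g by (simp add: \<delta>_def)
  \<comment> \<open>The condition on the second gradient holds at every iteration, so only the first
    gradient requires a choice of \<open>t\<close>.\<close>
  have grad_snd_le: "norm (grad_snd f (\<theta> t) (\<alpha> (Suc t))) \<le> \<epsilon>" if "t < T" for t
  proof (rule power2_le_imp_le)
    have "\<mu> * L22 \<le> (8 * Lbar) * Lbar"
      using \<open>\<mu> \<le> L22\<close> Lbar \<open>\<mu> > 0\<close> \<open>L22 > 0\<close> by (intro mult_mono) auto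
    then have "2 * L22 \<le> 16 * Lbar\<^sup>2 / \<mu>"
      using \<open>\<mu> > 0\<close> Lbar by (simp add: field_simps power2_eq_square)
    then have "2 * L22 * \<delta> t \<le> 16 * Lbar\<^sup>2 / \<mu> * \<delta> t"
      using \<delta>_nonneg by (intro mult_right_mono)
    then show "(norm (grad_snd f (\<theta> t) (\<alpha> (Suc t))))\<^sup>2 \<le> \<epsilon>\<^sup>2"
      using G.norm_B_le_gap[of "\<theta> t" "\<alpha> (Suc t)"] gap_Suc[OF that] by (simp add: \<delta>_def)
  qed (use \<open>\<epsilon> > 0\<close> in simp)
  have "\<exists>t<T. norm (grad_fst f (\<theta> t) (\<alpha> (Suc t))) \<le> \<epsilon>"
  proof (rule ccontr)
    assume "\<not> ?thesis"
    then have big: "\<epsilon> < norm (grad_fst f (\<theta> t) (\<alpha> (Suc t)))" if "t < T" for t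
      using that by force
    \<comment> \<open>The step gains at least \<open>\<epsilon>\<^sup>2 / (4 * L)\<close>, and the
      factor 16 in the bound on \<open>\<delta>\<close> limits the error to half of that.\<close>
    have "g (\<theta> (Suc t)) \<le> g (\<theta> t) - \<epsilon>\<^sup>2 / (8 * L)" if "t < T" for t
    proof -
      have "\<epsilon>\<^sup>2 / (4 * L) \<le> (norm (grad_fst f (\<theta> t) (\<alpha> (Suc t))))\<^sup>2 / (4 * L)"
        using big[OF that] \<open>\<epsilon> > 0\<close> L by (intro divide_right_mono power_mono) auto
      moreover have "2 * L12\<^sup>2 / (\<mu> * L) * \<delta> t \<le> \<epsilon>\<^sup>2 / (8 * L)"
      proof -
        have "L12\<^sup>2 \<le> Lbar\<^sup>2"
          using Lbar \<open>L12 > 0\<close> by (intro power_mono) auto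
        then have "16 * L12\<^sup>2 / \<mu> * \<delta> t \<le> 16 * Lbar\<^sup>2 / \<mu> * \<delta> t"
          using \<delta>_nonneg \<open>\<mu> > 0\<close> by (intro mult_right_mono divide_right_mono) auto
        then have "16 * L12\<^sup>2 / \<mu> * \<delta> t / (8 * L) \<le> \<epsilon>\<^sup>2 / (8 * L)"
          using gap_Suc[OF that] L by (intro divide_right_mono) auto
        then show ?thesis
          by (simp add: field_simps)
      qed
      moreover have "\<epsilon>\<^sup>2 / (4 * L) = \<epsilon>\<^sup>2 / (8 * L) + \<epsilon>\<^sup>2 / (8 * L)"
        by simp
      ultimately show ?thesis
        using G.g_outer_step[of "\<theta> t" "\<alpha> (Suc t)"] unfolding L(1) \<theta>_Suc[symmetric] \<delta>_def by linarith
    qed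
    then have "g (\<theta> T) \<le> g (\<theta> 0) - real T * (\<epsilon>\<^sup>2 / (8 * L))"
      by (rule telescope_decrease)
    moreover have "\<theta> 0 = \<theta>0"
      using iterates[of 0] by simp
    moreover have "(INF \<theta>'. g \<theta>') \<le> g (\<theta> T)"
      using \<open>attains_min g\<close>
      by (intro cINF_lower) (auto simp: attains_min_def is_arg_min_def not_less bdd_below_def)
    ultimately have "real T * (\<epsilon>\<^sup>2 / (8 * L)) \<le> \<Delta>g"
      by (simp add: \<Delta>g_eq)
    \<comment> \<open>The constant 18 exceeds 8, so for positive \<open>T\<close> the total decrease
      would be strictly larger than \<open>\<Delta>g\<close>.\<close>
    moreover have "\<Delta>g \<le> real T * (\<epsilon>\<^sup>2 / (18 * L))"
      using T_bound \<open>\<epsilon> > 0\<close> L by (simp add: field_simps)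
    moreover have "real T * (\<epsilon>\<^sup>2 / (18 * L)) < real T * (\<epsilon>\<^sup>2 / (8 * L))"
      using \<open>T > 0\<close> \<open>\<epsilon> > 0\<close> L by (intro mult_strict_left_mono divide_strict_left_mono) auto
    ultimately show False by linarith
  qed
  then show ?thesis
    using grad_snd_le by (auto simp: eps_stationary_def)
qed

end
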